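(* Let $q$ be a prime power and $d\geq0$ an integer. Then \[ \mathcal{R}(q,d)>\sum_{k=1}^{\min\{d,\lfloor\sqrt{q}\rfloor\}}\left(\frac{1}{k}\right)-4>\log\left(\min\{d,\lfloor\sqrt{q}\rfloor\}+1\right)-4. \]
   Context: A rational function on $\mathbb{P}^1(\mathbb{F}_q)$ is an element of $\mathbb{F}_q(x)$ or the constant function $\infty$; all constant functions, including the constant $\infty$, have degree $0$, and otherwise the degree of $f/g$ with $f,g\in\mathbb{F}_q[x]$ coprime is $\max\{\deg f,\deg g\}$. For a rational function $f$ on $\mathbb{P}^1(\mathbb{F}_q)$, the functional graph $\Gamma_f$ is the directed graph with vertex set $\mathbb{P}^1(\mathbb{F}_q)$ and an edge $\alpha\to\beta$ if and only if $f(\alpha)=\beta$. A $k$-cycle in $\Gamma_f$ is an orbit $\alpha_1\to\alpha_2\to\cdots\to\alpha_k\to\alpha_1$ under $f$ with $\alpha_1,\ldots,\alpha_k\in\mathbb{P}^1(\mathbb{F}_q)$ distinct (taken up to cyclic rotation); a cycle is a $k$-cycle for some $k\geq1$. The cycles of $\Gamma_f$ are in bijection with its connected components (connected components of the underlying undirected graph). $\mathcal{R}(q,d)$ denotes the average of $\left|\{\text{cycles in }\Gamma_f\}\right|$ over all rational functions $f$ on $\mathbb{P}^1(\mathbb{F}_q)$ of degree exactly $d$. $\log$ is the natural logarithm, and empty sums are $0$.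
   Formalization: For d = 0 the second inequality is asserted only as ≥, since both sides then equal −4 (the sum is empty and log 1 = 0) and the strict inequality fails; it is strict for all d > 0, and the first inequality is strict for all d ≥ 0. *)

theory Defs
  imports
    Complex_Main
    "HOL-Computational_Algebra.Polynomial"
    "HOL-Computational_Algebra.Fraction_Field"
    "HOL-Number_Theory.Prime_Powers"
begin

datatype 'a proj = Fin 'a | Infty

lemma UNIV_proj: "(UNIV :: 'a proj set) = insert Infty (range Fin)"
  by (auto intro: proj.exhaust)

instance proj :: (finite) finite
  by standard (simp add: UNIV_proj)

text \<open>
  A rational function on the projective line is an element of the field of fractions of the
  polynomial ring, or (constructor \<open>Infty\<close>) the constant function infinity.
\<close>
type_synonym 'a ratfun = "'a poly fract proj"

text \<open>
  The coprime representation of a fraction; making the denominator monic singles out one pair.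
  (The library's \<open>quot_of_fract\<close> is not available over an arbitrary field type, as it needs the
  coefficients to carry gcd operations.)
\<close>
definition is_reduced :: "'a::field poly fract \<Rightarrow> 'a poly \<Rightarrow> 'a poly \<Rightarrow> bool" where
  "is_reduced r f g \<longleftrightarrow> r = Fract f g \<and> coprime f g \<and> lead_coeff g = 1"

definition reduced :: "'a::field poly fract \<Rightarrow> 'a poly \<times> 'a poly" where
  "reduced r = (THE (f, g). is_reduced r f g)"

lemma is_reduced_exists:
  fixes r :: "'a::field poly fract"
  shows "\<exists>f g. is_reduced r f g"
proof -
  let ?P = "\<lambda>g. g \<noteq> 0 \<and> (\<exists>f. r = Fract f g)"
  have "\<exists>g. ?P g"
    by (cases r) auto
  then obtain g where g: "?P g" and min: "\<And>h. ?P h \<Longrightarrow> degree g \<le> degree h"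
    using ex_has_least_nat[of ?P _ degree] by blast
  then obtain f where f: "r = Fract f g"
    by blast
  have "coprime f g"
  proof (rule coprimeI)
    fix c assume "c dvd f" "c dvd g"
    then obtain f' g' where e: "f = c * f'" "g = c * g'"
      by (auto elim!: dvdE)
    with g have nz: "c \<noteq> 0" "g' \<noteq> 0"
      by auto
    with e f have "?P g'"
      by (auto simp: eq_fract)
    from min[OF this] nz have "degree c = 0"
      by (simp add: e degree_mult_eq)
    with nz show "is_unit c"
      by (simp add: is_unit_iff_degree)
  qed
  moreover define c where "c = inverse (lead_coeff g)"
  have c: "c \<noteq> 0"
    using g by (simp add: c_def)
  ultimately have "coprime (smult c f) (smult c g)"
    by (simp add: coprime_def dvd_smult_iff)
  moreover have "r = Fract (smult c f) (smult c g)"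
    using f g c by (simp add: eq_fract)
  moreover have "lead_coeff (smult c g) = 1"
    using g by (simp add: c_def)
  ultimately show ?thesis
    unfolding is_reduced_def by blast
qed

text \<open>As for \<open>quot_of_fract\<close>, the library's version of this fact needs gcd operations.\<close>
lemma coprime_poly_dvd_mult:
  fixes f g h :: "'a::field poly"
  assumes "coprime f g" and "g dvd f * h"
  shows "g dvd h"
proof -
  let ?P = "\<lambda>c. c \<noteq> 0 \<and> (\<exists>a b. c = a * f + b * g)"
  have "f \<noteq> 0 \<or> g \<noteq> 0"
    using assms(1) by auto
  then have "?P f \<or> ?P g"
    by (metis add.right_neutral add_0 mult_1 mult_zero_left)
  then obtain c where c: "?P c" and min: "\<And>c'. ?P c' \<Longrightarrow> degree c \<le> degree c'"
    using ex_has_least_nat[of ?P _ degree] by blast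
  then obtain a b where ab: "c = a * f + b * g"
    by blast
  have *: "c dvd u * f + v * g" for u v
  proof (rule ccontr)
    let ?r = "(u * f + v * g) mod c"
    assume "\<not> c dvd u * f + v * g"
    then have r: "?r \<noteq> 0"
      by (simp add: dvd_eq_mod_eq_0)
    define s where "s = (u * f + v * g) div c"
    have "?r = (u * f + v * g) - s * c"
      by (simp add: s_def minus_div_mult_eq_mod)
    also have "\<dots> = (u - s * a) * f + (v - s * b) * g"
      by (simp add: ab algebra_simps)
    finally have "?P ?r"
      using r by blast
    then have "degree c \<le> degree ?r"
      by (rule min)
    moreover have "degree ?r < degree c"
      using c r degree_mod_less by blast
    ultimately show False
      by simp
  qed
  have "c dvd f" "c dvd g"
    using *[of 1 0] *[of 0 1] by simp_all
  with assms(1) have "c dvd 1"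
    by (rule coprime_common_divisor)
  then obtain k where k: "1 = c * k"
    by (elim dvdE)
  have "h = k * (a * (f * h) + b * h * g)"
    using arg_cong[OF k, of "\<lambda>x. x * h"] by (simp add: ab algebra_simps)
  with assms(2) show ?thesis
    by (metis dvd_add dvd_mult dvd_triv_right)
qed

lemma is_reduced_unique:
  fixes r :: "'a::field poly fract"
  assumes "is_reduced r f g" "is_reduced r f' g'"
  shows "f = f' \<and> g = g'"
proof -
  have nz: "g \<noteq> 0" "g' \<noteq> 0"
    using assms by (auto simp: is_reduced_def)
  have eq: "f * g' = f' * g"
    using assms nz by (auto simp: is_reduced_def eq_fract)
  have "g dvd f * g'" "g' dvd f' * g"
    by (simp add: eq) (simp flip: eq)
  then have "g dvd g'" and "g' dvd g"
    using assms by (auto simp: is_reduced_def intro: coprime_poly_dvd_mult)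
  then obtain k where k: "g' = g * k"
    by (elim dvdE)
  have "degree g' \<le> degree g"
    using \<open>g' dvd g\<close> nz by (rule_tac dvd_imp_degree_le)
  then have "degree k = 0"
    using k nz by (auto simp: degree_mult_eq)
  moreover have "lead_coeff k = 1"
    using assms k by (simp add: is_reduced_def lead_coeff_mult)
  ultimately have "k = 1"
    by (auto elim!: degree_eq_zeroE)
  with k have "g = g'"
    by simp
  with eq nz show ?thesis
    by simp
qed

lemma is_reduced_iff_reduced: "is_reduced r f g \<longleftrightarrow> reduced r = (f, g)"
proof -
  obtain f0 g0 where r: "is_reduced r f0 g0"
    using is_reduced_exists[of r] by (elim exE)
  have "reduced r = (f0, g0)"
    unfolding reduced_def
  proof (rule the_equality)
    show "case (f0, g0) of (f, g) \<Rightarrow> is_reduced r f g"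
      using r by simp
  qed (use is_reduced_unique[OF _ r] in \<open>auto split: prod.splits\<close>)
  moreover have "is_reduced r f g \<longleftrightarrow> (f, g) = (f0, g0)"
    using r is_reduced_unique[OF _ r, of f g] by blast
  ultimately show ?thesis
    by (simp only: eq_commute)
qed

fun rat_degree :: "'a::field ratfun \<Rightarrow> nat" where
  "rat_degree Infty = 0"
| "rat_degree (Fin r) = (let (f, g) = reduced r in max (degree f) (degree g))"

text \<open>
  The value at infinity compares the coefficients of the top degree \<open>max (degree f) (degree g)\<close>,
  i.e. it evaluates the homogenised fraction at \<open>(1 : 0)\<close>.
\<close>
fun rat_eval :: "'a::field ratfun \<Rightarrow> 'a proj \<Rightarrow> 'a proj" where
  "rat_eval Infty x = Infty"
| "rat_eval (Fin r) (Fin a) =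
    (let (f, g) = reduced r
     in if poly g a = 0 then Infty else Fin (poly f a / poly g a))"
| "rat_eval (Fin r) Infty =
    (let (f, g) = reduced r; n = max (degree f) (degree g)
     in if coeff g n = 0 then Infty else Fin (coeff f n / coeff g n))"

text \<open>The vertex set of the functional graph is the whole type \<open>'a proj\<close>.\<close>
definition functional_graph :: "'a::field ratfun \<Rightarrow> ('a proj \<times> 'a proj) set" where
  "functional_graph F = {(x, y). rat_eval F x = y}"

definition cycle_lists :: "('v \<times> 'v) set \<Rightarrow> 'v list set" where
  "cycle_lists E = {xs. xs \<noteq> [] \<and> distinct xs \<and>
     (\<forall>i<length xs. (xs ! i, xs ! (Suc i mod length xs)) \<in> E)}"

definition cycles :: "('v \<times> 'v) set \<Rightarrow> 'v list set set" where
  "cycles E = cycle_lists E // {(xs, ys). \<exists>n. ys = rotate n xs}"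

definition ratfuns_of_degree :: "nat \<Rightarrow> 'a::field ratfun set" where
  "ratfuns_of_degree d = {F. rat_degree F = d}"

text \<open>The average, over the finite field \<open>'a\<close>, of the number of cycles.\<close>
definition avg_cycles :: "'a::{finite, field} itself \<Rightarrow> nat \<Rightarrow> real" where
  "avg_cycles T d =
     (\<Sum>F\<in>(ratfuns_of_degree d :: 'a ratfun set). real (card (cycles (functional_graph F)))) /
     real (card (ratfuns_of_degree d :: 'a ratfun set))"

text \<open>The finiteness facts that make \<open>sum\<close> and \<open>card\<close> above meaningful.\<close>

lemma finite_cycles:
  fixes E :: "('v::finite \<times> 'v) set"
  shows "finite (cycles E)"
proof -
  have "finite {xs :: 'v list. set xs \<subseteq> UNIV \<and> distinct xs}"
    by (rule finite_subset_distinct) simp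
  then have "finite (cycle_lists E)"
    by (rule rev_finite_subset) (auto simp: cycle_lists_def)
  then show ?thesis
    by (simp add: cycles_def quotient_def)
qed

lemma finite_ratfuns_of_degree:
  "finite (ratfuns_of_degree d :: 'a::{finite, field} ratfun set)"
proof -
  let ?B = "{p :: 'a poly. degree p \<le> d}"
  have "?B \<subseteq> Poly ` {xs. set xs \<subseteq> UNIV \<and> length xs \<le> Suc d}"
  proof
    fix p assume "p \<in> ?B"
    then have "length (coeffs p) \<le> Suc d"
      by (cases "p = 0") (auto simp: length_coeffs_degree)
    then show "p \<in> Poly ` {xs. set xs \<subseteq> UNIV \<and> length xs \<le> Suc d}"
      by (metis (mono_tags, lifting) Poly_coeffs image_eqI mem_Collect_eq subset_UNIV)
  qed
  moreover have "finite {xs :: 'a list. set xs \<subseteq> UNIV \<and> length xs \<le> Suc d}"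
    by (rule finite_lists_length_le) simp
  ultimately have "finite ?B"
    by (meson finite_imageI finite_subset)
  then have fin: "finite (insert Infty ((\<lambda>(f, g). Fin (Fract f g)) ` (?B \<times> ?B)))"
    by blast
  show ?thesis
  proof (rule finite_subset[OF _ fin], rule subsetI)
    fix F :: "'a ratfun"
    assume F: "F \<in> ratfuns_of_degree d"
    show "F \<in> insert Infty ((\<lambda>(f, g). Fin (Fract f g)) ` (?B \<times> ?B))"
    proof (cases F)
      case (Fin r)
      obtain f g where fg: "reduced r = (f, g)"
        by force
      then have "r = Fract f g"
        using is_reduced_iff_reduced[of r f g] by (simp add: is_reduced_def)
      with Fin fg F show ?thesis
        by (auto simp: ratfuns_of_degree_def intro!: image_eqI[of _ _ "(f, g)"])
    qed simp
  qed
qed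

end

theory Submission
  imports Defs
begin

text \<open>
  By linearity the average number of \<open>k\<close>-cycles is \<open>1/k\<close> times the sum, over lists of \<open>k\<close> distinct
  points, of the proportion of rational functions that interpolate the corresponding \<open>k\<close>
  prescribed values. For \<open>k \<le> d\<close> the interpolation conditions are independent linear conditions on
  pairs \<open>(f, g)\<close> of forms of degree \<open>d\<close>, so exactly \<open>q\<^sup>2\<^sup>d\<^sup>+\<^sup>2\<^sup>-\<^sup>k\<close> pairs satisfy them, and a union
  bound over common factors shows that at most a proportion \<open>3k/q\<close> of these pairs is not coprime.
  Since there are at least \<open>q\<^sup>k(1 - k\<^sup>2/q)\<close> lists of distinct points, the number of \<open>k\<close>-cycles is on
  average at least \<open>(1 - (k\<^sup>2 + 3k)/q)/k\<close>; summed over \<open>k \<le> \<surd>q\<close>, the total loss is below 4.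
\<close>

section \<open>Values and zeros of binary forms on the projective line\<close>

text \<open>The value at \<open>x\<close> of the homogenisation of \<open>p\<close> to a binary form of degree \<open>m \<ge> degree p\<close>.\<close>
definition hval :: "nat \<Rightarrow> 'a::field poly \<Rightarrow> 'a proj \<Rightarrow> 'a" where
  "hval m p x = (case x of Fin a \<Rightarrow> poly p a | Infty \<Rightarrow> coeff p m)"

lemma hval_simps [simp]:
  "hval m p (Fin a) = poly p a" "hval m p Infty = coeff p m"
  by (simp_all add: hval_def)

lemma hval_add: "hval m (p + r) x = hval m p x + hval m r x"
  by (cases x) simp_all

lemma hval_smult: "hval m (smult c p) x = c * hval m p x"
  by (cases x) simp_all

text \<open>Below index \<open>m\<close> the cofactor index exceeds \<open>n\<close>, and above it
  the index exceeds the degree of \<open>p\<close>, so one term of the convolution survives. This is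
  multiplicativity of evaluation at infinity.\<close>

lemma coeff_mult_add:
  fixes p r :: "'a::comm_semiring_1 poly"
  assumes "degree p \<le> m" "degree r \<le> n"
  shows "coeff (p * r) (m + n) = coeff p m * coeff r n"
proof -
  have "coeff p i * coeff r (m + n - i) = 0" if "i \<in> {..m + n} - {m}" for i
  proof (cases "i < m")
    case True
    then have "degree r < m + n - i" using assms by linarith
    then show ?thesis by (simp add: coeff_eq_0)
  next
    case False
    then have "degree p < i" using that assms by auto
    then show ?thesis by (simp add: coeff_eq_0)
  qed
  then have "(\<Sum>i\<le>m + n. coeff p i * coeff r (m + n - i))
      = (\<Sum>i\<in>{m}. coeff p i * coeff r (m + n - i))"
    by (intro sum.mono_neutral_right) auto
  then show ?thesis by (simp add: coeff_mult)
qed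

lemma hval_mult:
  assumes "degree p \<le> m" "degree r \<le> n"
  shows "hval (m + n) (p * r) x = hval m p x * hval n r x"
  using assms by (cases x) (simp_all add: coeff_mult_add)

text \<open>At infinity the linear form is the constant 1, taken as a form of degree 1.\<close>
definition point_form :: "'a::field proj \<Rightarrow> 'a poly" where
  "point_form t = (case t of Fin b \<Rightarrow> [:- b, 1:] | Infty \<Rightarrow> 1)"

lemma degree_point_form: "degree (point_form t) \<le> 1"
  by (cases t) (simp_all add: point_form_def)

lemma hval_point_form_eq_0: "hval 1 (point_form t) x = 0 \<longleftrightarrow> x = t"
  by (cases t; cases x) (simp_all add: point_form_def)

text \<open>Multiply the linear forms of the points of \<open>T\<close> and fill up the degree with
  a form that is nonzero at \<open>x\<close>: a constant if \<open>x\<close> is finite, but the top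
  monomial if \<open>x\<close> is infinity, where a constant of positive formal degree
  vanishes.\<close>

lemma separating_form:
  fixes x :: "'a::field proj"
  assumes "finite T" "card T \<le> m" "x \<notin> T"
  shows "\<exists>p. degree p \<le> m \<and> (\<forall>t\<in>T. hval m p t = 0) \<and> hval m p x \<noteq> 0"
  using assms
proof (induction T arbitrary: m rule: finite_induct)
  case empty
  show ?case
  proof (cases x)
    case (Fin a)
    then show ?thesis by (intro exI[of _ 1]) simp
  next
    case Infty
    then show ?thesis by (intro exI[of _ "monom 1 m"]) (simp add: degree_monom_eq)
  qed
next
  case (insert t T)
  then obtain n where m: "m = 1 + n"
    by (cases m) auto
  with insert obtain p where p: "degree p \<le> n" "\<forall>t\<in>T. hval n p t = 0" "hval n p x \<noteq> 0"
    by auto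
  have *: "hval m (point_form t * p) y = hval 1 (point_form t) y * hval n p y" for y
    unfolding m using degree_point_form p(1) by (rule hval_mult)
  have "degree (point_form t * p) \<le> m"
    using degree_mult_le[of "point_form t" p] degree_point_form[of t] p(1) m by linarith
  moreover have "hval 1 (point_form t) t = 0" "hval 1 (point_form t) x \<noteq> 0"
    using insert.prems by (auto simp only: hval_point_form_eq_0)
  ultimately show ?case
    using p by (intro exI[of _ "point_form t * p"]) (auto simp: *)
qed

section \<open>Counting pairs with prescribed values\<close>

text \<open>
  The 2 by 2 determinant whose vanishing says that \<open>(f : g)\<close> takes the value \<open>y\<close> at \<open>x\<close>; it also
  vanishes when \<open>f\<close> and \<open>g\<close> have \<open>x\<close> as a common zero.
\<close>
definition defect :: "nat \<Rightarrow> 'a::field proj \<Rightarrow> 'a proj \<Rightarrow> 'a poly \<times> 'a poly \<Rightarrow> 'a" where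
  "defect m y x = (\<lambda>(f, g). case y of Fin b \<Rightarrow> hval m f x - b * hval m g x | Infty \<Rightarrow> hval m g x)"

lemma defect_add_smult:
  "defect m y x (f + smult c u, g + smult c v) = defect m y x (f, g) + c * defect m y x (u, v)"
  by (cases y) (simp_all add: defect_def hval_add hval_smult algebra_simps)

lemma defect_mult:
  assumes "degree h \<le> e" "degree f \<le> m" "degree g \<le> m"
  shows "defect (e + m) y x (h * f, h * g) = hval e h x * defect m y x (f, g)"
  using hval_mult[OF assms(1,2), of x] hval_mult[OF assms(1,3), of x]
  by (cases y) (simp_all add: defect_def right_diff_distrib)

text \<open>The zero pair and pairs with a common zero in \<open>T\<close> count as solutions, which
  makes this a vector space. Only the values of \<beta> on \<open>T\<close> matter.\<close>

definition interp :: "nat \<Rightarrow> ('a::field proj \<Rightarrow> 'a proj) \<Rightarrow> 'a proj set \<Rightarrow> ('a poly \<times> 'a poly) set" where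
  "interp m \<beta> T = {(f, g). degree f \<le> m \<and> degree g \<le> m \<and> (\<forall>x\<in>T. defect m (\<beta> x) x (f, g) = 0)}"

lemma card_degree_le:
  "finite {p :: 'a::{finite, field} poly. degree p \<le> m} \<and>
   card {p :: 'a poly. degree p \<le> m} = card (UNIV :: 'a set) ^ (m + 1)"
proof (induction m)
  case 0
  have "{p :: 'a poly. degree p \<le> 0} = (\<lambda>a. [:a:]) ` UNIV"
    by (auto elim!: degree_eq_zeroE)
  moreover have "inj (\<lambda>a::'a. [:a:])"
    by (auto intro: injI)
  ultimately show ?case
    by (simp add: card_image)
next
  case (Suc m)
  have "{p :: 'a poly. degree p \<le> Suc m} = (\<lambda>(a, p). pCons a p) ` (UNIV \<times> {p. degree p \<le> m})"
  proof (intro equalityI subsetI)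
    fix p :: "'a poly" assume "p \<in> {p. degree p \<le> Suc m}"
    then show "p \<in> (\<lambda>(a, p). pCons a p) ` (UNIV \<times> {p. degree p \<le> m})"
      by (cases p) (auto simp: degree_pCons_eq_if split: if_splits)
  qed (auto simp: degree_pCons_eq_if)
  moreover have "inj_on (\<lambda>(a, p). pCons a p) (UNIV \<times> {p :: 'a poly. degree p \<le> m})"
    by (auto intro: inj_onI)
  ultimately show ?case
    using Suc by (simp add: card_image card_cartesian_product)
qed

lemma finite_interp: "finite (interp m \<beta> T :: ('a::{finite, field} poly \<times> 'a poly) set)"
proof (rule finite_subset)
  show "interp m \<beta> T \<subseteq> {p. degree p \<le> m} \<times> {p. degree p \<le> m}"
    by (auto simp: interp_def)
qed (use card_degree_le in blast)

lemma interp_antimono: "T \<subseteq> T' \<Longrightarrow> interp m \<beta> T' \<subseteq> interp m \<beta> T"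
  by (auto simp: interp_def)

text \<open>
  A pair that satisfies the conditions on \<open>T\<close> but not the one at \<open>x\<close> spans a complement of
  \<open>interp m \<beta> (insert x T)\<close> in \<open>interp m \<beta> T\<close>.
\<close>
lemma card_interp_insert:
  fixes x :: "'a::{finite, field} proj"
  assumes "card T \<le> m" "x \<notin> T"
  shows "card (interp m \<beta> T) = card (UNIV :: 'a set) * card (interp m \<beta> (insert x T))"
proof -
  obtain p where p: "degree p \<le> m" "\<forall>t\<in>T. hval m p t = 0" "hval m p x \<noteq> 0"
    using separating_form[of T m x] assms by auto
  \<comment> \<open>\<open>p\<close> goes into a component that enters the condition at
    \<open>x\<close> with coefficient 1: the numerator for a finite target, the denominator for
    infinity.\<close>
  define w where "w = (case \<beta> x of Fin b \<Rightarrow> (p, 0) | Infty \<Rightarrow> (0, p))"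
  obtain u v where uv: "w = (u, v)" by force
  have deg: "degree u \<le> m" "degree v \<le> m"
    using p uv by (auto simp: w_def split: proj.splits)
  have zero: "hval m (0 :: 'a poly) y = 0" for y
    by (cases y) simp_all
  have "hval m u t = 0 \<and> hval m v t = 0" if "t \<in> T" for t
    using p uv that by (auto simp: w_def zero split: proj.splits)
  then have wT: "defect m (\<beta> t) t (u, v) = 0" if "t \<in> T" for t
    using that by (auto simp: defect_def split: proj.splits)
  have wx: "defect m (\<beta> x) x (u, v) \<noteq> 0"
    using p uv by (auto simp: w_def defect_def zero split: proj.splits)
  let ?\<phi> = "\<lambda>(c, (f, g)). (f + smult c u, g + smult c v)"
  have "bij_betw ?\<phi> (UNIV \<times> interp m \<beta> (insert x T)) (interp m \<beta> T)"
    unfolding bij_betw_def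
  proof
    have inj: "c = c' \<and> f = f' \<and> g = g'"
      if "(f, g) \<in> interp m \<beta> (insert x T)" "(f', g') \<in> interp m \<beta> (insert x T)"
        "f + smult c u = f' + smult c' u" "g + smult c v = g' + smult c' v" for c c' f g f' g'
    proof -
      have "defect m (\<beta> x) x (f + smult c u, g + smult c v)
          = defect m (\<beta> x) x (f' + smult c' u, g' + smult c' v)"
        using that by simp
      then have "c = c'"
        using that(1,2) wx by (simp add: defect_add_smult interp_def)
      with that show ?thesis by simp
    qed
    show "inj_on ?\<phi> (UNIV \<times> interp m \<beta> (insert x T))"
      by (rule inj_onI) (use inj in \<open>auto simp only: split_paired_all prod.case prod.inject mem_Times_iff fst_conv snd_conv\<close>)
    show "?\<phi> ` (UNIV \<times> interp m \<beta> (insert x T)) = interp m \<beta> T"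
    proof (intro equalityI subsetI)
      fix z assume "z \<in> ?\<phi> ` (UNIV \<times> interp m \<beta> (insert x T))"
      then show "z \<in> interp m \<beta> T"
        using deg by (auto simp: interp_def defect_add_smult wT intro!: degree_add_le
            order.trans[OF degree_smult_le])
    next
      fix z assume z: "z \<in> interp m \<beta> T"
      obtain f g where fg: "z = (f, g)" by force
      \<comment> \<open>This multiple of \<open>(u, v)\<close> has the same defect at
        \<open>x\<close> as \<open>(f, g)\<close>; subtracting it meets the condition at
        \<open>x\<close> and leaves those on \<open>T\<close> intact.\<close>
      define c where "c = defect m (\<beta> x) x (f, g) / defect m (\<beta> x) x (u, v)"
      have "(f + smult (- c) u, g + smult (- c) v) \<in> interp m \<beta> (insert x T)"
        using z fg deg wx by (auto simp: interp_def defect_add_smult wT c_def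
            simp del: smult_minus_left intro!: degree_add_le order.trans[OF degree_smult_le])
      then show "z \<in> ?\<phi> ` (UNIV \<times> interp m \<beta> (insert x T))"
        by (intro image_eqI[of _ _ "(c, (f + smult (- c) u, g + smult (- c) v))"])
          (auto simp: fg)
    qed
  qed
  then have "card (interp m \<beta> T) = card ((UNIV :: 'a set) \<times> interp m \<beta> (insert x T))"
    by (simp add: bij_betw_same_card)
  then show ?thesis
    by (simp add: card_cartesian_product)
qed

text \<open>The pairs have \<open>2 * m + 2\<close> coefficients, and every new point divides the
  count by the field size. The last point joins at most \<open>m\<close> earlier ones, so
  \<open>m + 1\<close> points still give independent conditions.\<close>

lemma card_interp:
  fixes T :: "'a::{finite, field} proj set"
  assumes "card T \<le> m + 1"
  shows "card (interp m \<beta> T) = card (UNIV :: 'a set) ^ (2 * m + 2 - card T)"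
proof -
  have "finite T" by simp
  then show ?thesis using assms
  proof (induction T rule: finite_induct)
    case empty
    have "interp m \<beta> {} = {p. degree p \<le> m} \<times> {p. degree p \<le> m}"
      by (auto simp: interp_def)
    then show ?case
      using card_degree_le[of m, where 'a = 'a]
      by (simp add: card_cartesian_product power_add mult_2)
  next
    case (insert x T)
    then have "card (UNIV :: 'a set) * card (interp m \<beta> (insert x T))
        = card (UNIV :: 'a set) ^ (2 * m + 2 - card T)"
      using card_interp_insert[of T m x \<beta>] by simp
    also have "2 * m + 2 - card T = Suc (2 * m + 2 - card (insert x T))"
      using insert by simp
    finally show ?case by simp
  qed
qed

text \<open>Beyond \<open>m + 1\<close> points the conditions may be dependent; keeping
  \<open>m + 1\<close> of them gives an upper bound.\<close>

lemma card_interp_le: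
  fixes T :: "'a::{finite, field} proj set"
  shows "card (interp m \<beta> T) \<le> card (UNIV :: 'a set) ^ (2 * m + 2 - min (card T) (m + 1))"
proof -
  obtain T' where T': "T' \<subseteq> T" "card T' = min (card T) (m + 1)"
    using obtain_subset_with_card_n[of "min (card T) (m + 1)" T] by auto
  have "card (interp m \<beta> T) \<le> card (interp m \<beta> T')"
    by (rule card_mono[OF finite_interp interp_antimono[OF T'(1)]])
  with T' show ?thesis by (simp add: card_interp)
qed

section \<open>Cycles as weighted lists\<close>

lemma sum_Union_le:
  fixes f :: "'b \<Rightarrow> real"
  assumes "finite \<A>" "\<And>C. C \<in> \<A> \<Longrightarrow> finite C" "\<And>x. f x \<ge> 0"
  shows "sum f (\<Union>\<A>) \<le> (\<Sum>C\<in>\<A>. sum f C)"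
  using assms(1,2)
proof (induction \<A> rule: finite_induct)
  case (insert C \<A>)
  have "sum f (C \<union> \<Union>\<A>) + sum f (C \<inter> \<Union>\<A>) = sum f C + sum f (\<Union>\<A>)"
    using insert by (intro sum.union_inter) auto
  moreover have "sum f (C \<inter> \<Union>\<A>) \<ge> 0"
    using assms(3) by (intro sum_nonneg)
  moreover have "sum f (\<Union>\<A>) \<le> (\<Sum>C\<in>\<A>. sum f C)"
    using insert by blast
  ultimately show ?case
    using insert.hyps by simp
qed simp

text \<open>A rotation class of lists of length k has at most k members, so the weights 1/k add up
  to at most 1 on each cycle. Subadditivity over the classes takes the place of their
  disjointness.\<close>

lemma card_cycles_ge:
  fixes E :: "('v::finite \<times> 'v) set"
  shows "(\<Sum>xs\<in>cycle_lists E. 1 / real (length xs)) \<le> real (card (cycles E))"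
proof -
  let ?r = "{(xs, ys :: 'v list). \<exists>n. ys = rotate n xs}"
  have sum_class: "finite C \<and> (\<Sum>xs\<in>C. 1 / real (length xs)) \<le> 1" if C: "C \<in> cycles E" for C
  proof -
    obtain xs where xs: "xs \<in> cycle_lists E" "C = {ys. \<exists>n. ys = rotate n xs}"
      using C by (auto simp: cycles_def quotient_def)
    let ?k = "length xs"
    have k: "?k > 0" using xs by (auto simp: cycle_lists_def)
    have "C = (\<lambda>n. rotate n xs) ` {..<?k}"
    proof (intro equalityI subsetI)
      fix ys assume "ys \<in> C"
      then obtain n where "ys = rotate n xs" using xs by auto
      then have "ys = rotate (n mod ?k) xs" by (metis rotate_conv_mod)
      then show "ys \<in> (\<lambda>n. rotate n xs) ` {..<?k}" using k by simp
    qed (use xs in auto)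
    moreover from this have "card C \<le> ?k"
      using card_image_le[of "{..<?k}" "\<lambda>n. rotate n xs"] by simp
    moreover have "(\<Sum>ys\<in>C. 1 / real (length ys)) = (\<Sum>ys\<in>C. 1 / real ?k)"
      using xs by (intro sum.cong) auto
    ultimately show ?thesis using k by simp
  qed
  have fin: "finite (\<Union>(cycles E))"
    using finite_cycles sum_class by blast
  have "cycle_lists E \<subseteq> \<Union>(cycles E)"
  proof
    fix xs assume "xs \<in> cycle_lists E"
    then have "?r `` {xs} \<in> cycles E"
      unfolding cycles_def by (rule quotientI)
    moreover have "xs = rotate 0 xs"
      by simp
    then have "xs \<in> ?r `` {xs}"
      by blast
    ultimately show "xs \<in> \<Union>(cycles E)" by blast
  qed
  then have "(\<Sum>xs\<in>cycle_lists E. 1 / real (length xs)) \<le> (\<Sum>xs\<in>\<Union>(cycles E). 1 / real (length xs))"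
    using fin by (intro sum_mono2) auto
  also have "\<dots> \<le> (\<Sum>C\<in>cycles E. \<Sum>xs\<in>C. 1 / real (length xs))"
    using sum_class finite_cycles by (intro sum_Union_le) auto
  also have "\<dots> \<le> (\<Sum>C\<in>cycles E. 1)"
    using sum_class by (intro sum_mono) blast
  finally show ?thesis by simp
qed

section \<open>Coprime pairs as representatives of rational functions\<close>

definition coprime_pairs :: "nat \<Rightarrow> ('a::field poly \<times> 'a poly) set" where
  "coprime_pairs d = {(f, g). coprime f g \<and> max (degree f) (degree g) = d}"

definition mult_pair :: "'a::field poly \<Rightarrow> 'a poly \<times> 'a poly \<Rightarrow> 'a poly \<times> 'a poly" where
  "mult_pair h = (\<lambda>(f, g). (h * f, h * g))"

text \<open>This excludes the spurious solutions of the determinant condition: on coprime pairs, a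
  vanishing \<open>defect\<close> means that the quotient takes the prescribed value. At infinity it
  holds because one of the two degrees is exactly \<open>d\<close>.\<close>

lemma coprime_pairs_no_common_zero:
  assumes "(f, g) \<in> coprime_pairs d" "d > 0"
  shows "hval d f x \<noteq> 0 \<or> hval d g x \<noteq> 0"
proof (rule ccontr)
  assume "\<not> ?thesis"
  then have z: "hval d f x = 0" "hval d g x = 0" by auto
  show False
  proof (cases x)
    case (Fin a)
    with z have "[:- a, 1:] dvd f" "[:- a, 1:] dvd g"
      by (simp_all add: poly_eq_0_iff_dvd)
    with assms have "is_unit [:- a, 1:]"
      by (auto simp: coprime_pairs_def intro: coprime_common_divisor)
    then show False
      by (simp add: is_unit_iff_degree)
  next
    case Infty
    with z assms show False
      by (auto simp: coprime_pairs_def max_def split: if_splits)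
  qed
qed

lemma rat_eval_Fin:
  assumes "reduced r = (f, g)" "max (degree f) (degree g) = d"
  shows "rat_eval (Fin r) x = (if hval d g x = 0 then Infty else Fin (hval d f x / hval d g x))"
  using assms by (cases x) (simp_all add: Let_def)

text \<open>A rational function has one coprime pair for each nonzero scalar \<open>c\<close>. The
  value at \<open>Infty\<close> is a dummy: that function has degree 0, while all uses concern
  degree \<open>d > 0\<close>.\<close>

definition scaled_pair :: "'a::field ratfun \<times> 'a \<Rightarrow> 'a poly \<times> 'a poly" where
  "scaled_pair = (\<lambda>(F, c). case F of
     Fin r \<Rightarrow> (smult c (fst (reduced r)), smult c (snd (reduced r))) | Infty \<Rightarrow> (0, 0))"

lemma reducedD:
  assumes "reduced r = (f, g)"
  shows "r = Fract f g" "coprime f g" "lead_coeff g = 1"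
  using assms is_reduced_iff_reduced[of r f g] by (simp_all add: is_reduced_def)

lemma ratfuns_of_degree_cases:
  assumes "F \<in> ratfuns_of_degree d" "d > 0"
  obtains r f g where "F = Fin r" "reduced r = (f, g)" "max (degree f) (degree g) = d"
proof (cases F)
  case (Fin r)
  obtain f g where "reduced r = (f, g)" by force
  with Fin assms that show ?thesis by (simp add: ratfuns_of_degree_def)
qed (use assms in \<open>simp add: ratfuns_of_degree_def\<close>)

text \<open>\<open>scaled_pair\<close> is injective on nonzero scalars, since the reduced
  denominator is monic and \<open>c\<close> is therefore the leading coefficient of the second
  component. An upper bound suffices because this count will be a denominator.\<close>

lemma card_ratfuns_of_degree_le:
  assumes "d > 0"
  shows "card (ratfuns_of_degree d :: 'a::{finite, field} ratfun set) * (card (UNIV :: 'a set) - 1)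
    \<le> card (UNIV :: 'a set) ^ (2 * d + 2)"
proof -
  let ?R = "ratfuns_of_degree d :: 'a ratfun set"
  let ?V = "{p :: 'a poly. degree p \<le> d}"
  have inj: "F = F' \<and> c = c'"
    if *: "F \<in> ?R" "F' \<in> ?R" "c \<noteq> 0" "c' \<noteq> 0" "scaled_pair (F, c) = scaled_pair (F', c')"
    for F F' c c'
  proof -
    obtain r f g where F: "F = Fin r" "reduced r = (f, g)"
      using *(1) assms by (rule ratfuns_of_degree_cases)
    obtain r' f' g' where F': "F' = Fin r'" "reduced r' = (f', g')"
      using *(2) assms by (rule ratfuns_of_degree_cases)
    have eq: "smult c f = smult c' f'" "smult c g = smult c' g'"
      using *(5) F F' by (simp_all add: scaled_pair_def)
    have "c = lead_coeff (smult c g)"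
      using reducedD(3)[OF F(2)] by simp
    also have "\<dots> = c'"
      unfolding eq using reducedD(3)[OF F'(2)] by simp
    finally have "c = c'" .
    with eq *(3) have "f = f'" "g = g'"
      by (auto dest: arg_cong[of _ _ "smult (inverse c)"])
    with \<open>c = c'\<close> show ?thesis
      using F F' reducedD(1)[OF F(2)] reducedD(1)[OF F'(2)] by simp
  qed
  have "inj_on scaled_pair (?R \<times> (UNIV - {0}))"
    by (rule inj_onI) (use inj in \<open>auto simp only: split_paired_all mem_Times_iff fst_conv snd_conv
        prod.inject Diff_iff singleton_iff\<close>)
  then have "card (?R \<times> (UNIV - {0 :: 'a})) = card (scaled_pair ` (?R \<times> (UNIV - {0 :: 'a})))"
    by (simp add: card_image)
  also have "\<dots> \<le> card (?V \<times> ?V)"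
  proof (rule card_mono)
    show "scaled_pair ` (?R \<times> (UNIV - {0})) \<subseteq> ?V \<times> ?V"
    proof (rule image_subsetI)
      fix z :: "'a ratfun \<times> 'a"
      assume "z \<in> ?R \<times> (UNIV - {0})"
      then obtain F c where z: "z = (F, c)" and F: "F \<in> ?R" by auto
      from F obtain r f g where "F = Fin r" "reduced r = (f, g)" "max (degree f) (degree g) = d"
        using assms by (rule ratfuns_of_degree_cases)
      then show "scaled_pair z \<in> ?V \<times> ?V"
        by (auto simp: z scaled_pair_def intro: order.trans[OF degree_smult_le])
    qed
  qed (use card_degree_le in auto)
  also have "card (?V \<times> ?V) = card (UNIV :: 'a set) ^ (2 * d + 2)"
    using card_degree_le[of d, where 'a = 'a] by (simp add: card_cartesian_product power_add mult_2)
  finally show ?thesis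
    by (simp add: card_cartesian_product card_Diff_subset)
qed

text \<open>Conversely, a coprime interpolating pair is the \<open>scaled_pair\<close> of an
  interpolating function, with the leading coefficient of \<open>g\<close> as scalar. Here
  \<open>g\<close> is nonzero, as otherwise \<open>f\<close> would be a unit of degree
  \<open>d > 0\<close>.\<close>

lemma card_interp_coprime_le:
  fixes S :: "'a::{finite, field} proj set"
  assumes "d > 0"
  shows "card (interp d \<beta> S \<inter> coprime_pairs d)
    \<le> card {F \<in> ratfuns_of_degree d. \<forall>x\<in>S. rat_eval F x = \<beta> x} * (card (UNIV :: 'a set) - 1)"
proof -
  let ?A = "{F \<in> ratfuns_of_degree d. \<forall>x\<in>S. rat_eval F x = \<beta> x}"
  have fin: "finite ?A"
    using finite_ratfuns_of_degree[of d, where 'a = 'a] by simp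
  have "interp d \<beta> S \<inter> coprime_pairs d \<subseteq> scaled_pair ` (?A \<times> (UNIV - {0}))"
  proof clarify
    fix f g assume fg: "(f, g) \<in> interp d \<beta> S" "(f, g) \<in> coprime_pairs d"
    have "g \<noteq> 0"
    proof
      assume "g = 0"
      with fg assms have "is_unit f" "degree f > 0"
        by (auto simp: coprime_pairs_def)
      then show False by (cases "f = 0") (auto simp: is_unit_iff_degree)
    qed
    define c where "c = lead_coeff g"
    define f0 g0 where "f0 = smult (inverse c) f" "g0 = smult (inverse c) g"
    have c: "c \<noteq> 0" using \<open>g \<noteq> 0\<close> by (simp add: c_def)
    define r where "r = Fract f g"
    have "coprime f0 g0"
      using fg(2) c by (simp add: coprime_pairs_def f0_g0_def coprime_def dvd_smult_iff)
    moreover have "r = Fract f0 g0"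
      using c \<open>g \<noteq> 0\<close> by (simp add: r_def f0_g0_def eq_fract)
    moreover have "lead_coeff g0 = 1"
      using c by (simp add: f0_g0_def c_def)
    ultimately have red: "reduced r = (f0, g0)"
      by (simp add: is_reduced_def flip: is_reduced_iff_reduced)
    have deg: "max (degree f0) (degree g0) = d"
      using fg(2) c by (simp add: f0_g0_def coprime_pairs_def)
    have "rat_eval (Fin r) x = \<beta> x" if x: "x \<in> S" for x
    proof -
      have 1: "defect d (\<beta> x) x (f, g) = 0"
        using fg(1) x by (simp add: interp_def)
      have 2: "hval d f x \<noteq> 0 \<or> hval d g x \<noteq> 0"
        using fg(2) assms by (rule coprime_pairs_no_common_zero)
      from 1 2 show ?thesis
        unfolding rat_eval_Fin[OF red deg] using c
        by (cases "\<beta> x") (auto simp: defect_def f0_g0_def hval_smult)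
    qed
    then have "Fin r \<in> ?A"
      using red deg by (simp add: ratfuns_of_degree_def)
    moreover have "(f, g) = scaled_pair (Fin r, c)"
      using red c by (simp add: scaled_pair_def f0_g0_def)
    ultimately show "(f, g) \<in> scaled_pair ` (?A \<times> (UNIV - {0}))"
      using c by (intro image_eqI[of _ _ "(Fin r, c)"]) auto
  qed
  then have "card (interp d \<beta> S \<inter> coprime_pairs d) \<le> card (?A \<times> (UNIV - {0 :: 'a}))"
    using fin by (intro surj_card_le) auto
  then show ?thesis
    by (simp add: card_cartesian_product card_Diff_subset)
qed

section \<open>Pairs with a common factor\<close>

text \<open>The factor theorem for binary forms. At infinity the polynomial itself stays the same
  and only its degree bound drops, because the coefficient of index \<open>1 + m\<close>
  vanishes.\<close>

lemma divide_point_form: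
  assumes "degree f \<le> 1 + m" "hval (1 + m) f t = 0"
  shows "\<exists>f'. degree f' \<le> m \<and> f = point_form t * f'"
proof (cases t)
  case (Fin a)
  then obtain f' where f': "f = [:- a, 1:] * f'"
    using assms(2) by (auto simp: poly_eq_0_iff_dvd elim: dvdE)
  have "degree f' \<le> m"
  proof (cases "f' = 0")
    case False
    have "degree f = 1 + degree f'"
      unfolding f' using False by (subst degree_mult_eq) auto
    then show ?thesis using assms(1) by simp
  qed simp
  then show ?thesis
    using f' Fin by (auto simp: point_form_def)
next
  case Infty
  have "degree f \<le> m"
    by (rule degree_le) (metis Infty Suc_lessI assms coeff_eq_0 hval_simps(2) le_less_trans
        plus_1_eq_Suc)
  then show ?thesis
    using Infty by (auto simp: point_form_def)
qed

text \<open>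
  A common linear factor absorbs the condition at its zero. A common factor without rational zeros
  absorbs none, and it need not be taken irreducible.
\<close>
lemma not_coprime_interp_cases:
  assumes fg: "(f, g) \<in> interp d \<beta> S" "(f, g) \<notin> coprime_pairs d" and d: "d > 0"
  shows "(\<exists>t. (f, g) \<in> mult_pair (point_form t) ` interp (d - 1) \<beta> (S - {t})) \<or>
    (\<exists>e\<in>{2..d}. \<exists>h. degree h = e \<and> lead_coeff h = 1 \<and> (f, g) \<in> mult_pair h ` interp (d - e) \<beta> S)"
proof (cases "\<exists>t. hval d f t = 0 \<and> hval d g t = 0")
  case True
  then obtain t where t: "hval d f t = 0" "hval d g t = 0" by blast
  define m where "m = d - 1"
  have dm: "d = 1 + m" using d by (simp add: m_def)
  have deg: "degree f \<le> 1 + m" "degree g \<le> 1 + m"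
    using fg dm by (auto simp: interp_def)
  obtain f' g' where f': "degree f' \<le> m" "f = point_form t * f'"
    and g': "degree g' \<le> m" "g = point_form t * g'"
    using divide_point_form deg t unfolding dm by metis
  have "defect m (\<beta> x) x (f', g') = 0" if x: "x \<in> S - {t}" for x
  proof -
    have "hval 1 (point_form t) x * defect m (\<beta> x) x (f', g') = defect d (\<beta> x) x (f, g)"
      unfolding dm f'(2) g'(2) using degree_point_form f'(1) g'(1) by (rule defect_mult[symmetric])
    also have "\<dots> = 0"
      using fg(1) x by (simp add: interp_def)
    finally show ?thesis
      using x by (auto simp only: mult_eq_0_iff hval_point_form_eq_0)
  qed
  then have "(f', g') \<in> interp (d - 1) \<beta> (S - {t})"
    using f' g' by (simp add: interp_def m_def)
  then have "(f, g) \<in> mult_pair (point_form t) ` interp (d - 1) \<beta> (S - {t})"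
    using f' g' by (intro image_eqI[of _ _ "(f', g')"]) (simp_all add: mult_pair_def)
  then show ?thesis by blast
next
  case False
  have deg: "degree f \<le> d" "degree g \<le> d"
    using fg by (auto simp: interp_def)
  \<comment> \<open>Infinity is no common zero, so one degree equals \<open>d\<close>; what fails
    for membership in \<open>coprime_pairs\<close> is then coprimality itself.\<close>
  have Inf: "coeff f d \<noteq> 0 \<or> coeff g d \<noteq> 0"
    using False hval_simps(2) by metis
  then have maxd: "max (degree f) (degree g) = d"
    using deg le_degree[of f d] le_degree[of g d] by linarith
  then have "\<not> coprime f g"
    using fg(2) by (simp add: coprime_pairs_def)
  then obtain c where c: "c dvd f" "c dvd g" "\<not> is_unit c"
    by (auto simp: coprime_def)
  have nz: "f \<noteq> 0 \<or> g \<noteq> 0"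
    using Inf by auto
  then have "c \<noteq> 0" using c by auto
  define h where "h = smult (inverse (lead_coeff c)) c"
  have h: "h dvd f" "h dvd g" "lead_coeff h = 1" "degree h = degree c"
    using c \<open>c \<noteq> 0\<close> by (simp_all add: h_def smult_dvd_iff)
  define e where "e = degree h"
  have noroot: "hval e h x \<noteq> 0" for x
  proof (cases x)
    case (Fin a)
    have "poly f a = 0 \<and> poly g a = 0" if "poly h a = 0"
      using that h(1,2) by (auto elim!: dvdE)
    then have "poly h a \<noteq> 0"
      using False hval_simps(1) by metis
    then show ?thesis using Fin by simp
  qed (use h in \<open>simp add: e_def\<close>)
  have "e \<noteq> 0"
    using c \<open>c \<noteq> 0\<close> h(4) by (simp add: e_def is_unit_iff_degree)
  \<comment> \<open>A linear factor would have a rational zero, against \<open>noroot\<close>; this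
    is why the degrees start at 2.\<close>
  moreover have "e \<noteq> 1"
  proof
    assume "e = 1"
    then obtain b a where "h = [:b, a:]"
      unfolding e_def by (cases h) (auto split: if_splits elim!: degree_eq_zeroE)
    with h(3) \<open>e = 1\<close> have "poly h (- b) = 0"
      by (auto simp: e_def)
    then show False using noroot[of "Fin (- b)"] by simp
  qed
  moreover have "e \<le> d"
    using nz h(1,2) deg dvd_imp_degree_le[of h f] dvd_imp_degree_le[of h g] by (auto simp: e_def)
  ultimately have e: "e \<in> {2..d}" by auto
  obtain f' g' where f': "f = h * f'" and g': "g = h * g'"
    using h(1,2) by (auto elim!: dvdE)
  have "h \<noteq> 0" using h(3) by auto
  have deg': "degree p' \<le> d - e" if "degree (h * p') \<le> d" for p'
    using that \<open>h \<noteq> 0\<close> by (cases "p' = 0") (simp_all add: degree_mult_eq e_def)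
  have degs: "degree f' \<le> d - e" "degree g' \<le> d - e"
    using deg f' g' by (auto intro: deg')
  have "defect (d - e) (\<beta> x) x (f', g') = 0" if x: "x \<in> S" for x
  proof -
    have "hval e h x * defect (d - e) (\<beta> x) x (f', g') = defect (e + (d - e)) (\<beta> x) x (f, g)"
      unfolding f' g' using degs by (intro defect_mult[symmetric]) (auto simp: e_def)
    also have "\<dots> = 0"
      using fg(1) x e by (simp add: interp_def)
    finally show ?thesis
      using noroot[of x] by simp
  qed
  then have "(f', g') \<in> interp (d - e) \<beta> S"
    using degs by (simp add: interp_def)
  then have "(f, g) \<in> mult_pair h ` interp (d - e) \<beta> S"
    using f' g' by (intro image_eqI[of _ _ "(f', g')"]) (simp_all add: mult_pair_def)
  then show ?thesis
    using e h(3) e_def by blast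
qed

lemma card_monic_le:
  assumes "e > 0"
  shows "finite {h :: 'a::{finite, field} poly. degree h = e \<and> lead_coeff h = 1} \<and>
    card {h :: 'a poly. degree h = e \<and> lead_coeff h = 1} \<le> card (UNIV :: 'a set) ^ e"
proof -
  have fin: "finite {p :: 'a poly. degree p \<le> e - 1}"
    using card_degree_le by blast
  have *: "{h :: 'a poly. degree h = e \<and> lead_coeff h = 1}
      \<subseteq> (\<lambda>p. monom 1 e + p) ` {p. degree p \<le> e - 1}"
  proof clarify
    fix h :: "'a poly" assume h: "lead_coeff h = 1" "e = degree h"
    have "degree (h - monom 1 (degree h)) \<le> degree h - 1"
    proof (rule degree_le, clarify)
      fix i assume "degree h - 1 < i"
      then show "coeff (h - monom 1 (degree h)) i = 0"
        using h by (cases "i = degree h") (auto simp: coeff_eq_0)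
    qed
    then show "h \<in> (\<lambda>p. monom 1 (degree h) + p) ` {p. degree p \<le> degree h - 1}"
      by (intro image_eqI[of _ _ "h - monom 1 (degree h)"]) auto
  qed
  have "card {h :: 'a poly. degree h = e \<and> lead_coeff h = 1} \<le> card {p :: 'a poly. degree p \<le> e - 1}"
    by (rule surj_card_le[OF fin *])
  also have "\<dots> = card (UNIV :: 'a set) ^ e"
    using card_degree_le[of "e - 1", where 'a = 'a] assms by simp
  finally show ?thesis
    using finite_subset[OF *] fin by blast
qed

text \<open>A union bound over the possible factors: one linear form for each point, and in each
  degree \<open>e\<close> from 2 on at most as many monic polynomials as the \<open>e\<close>-th
  power of the field size.\<close>

lemma card_not_coprime_interp_le:
  fixes S :: "'a::{finite, field} proj set"
  assumes "d > 0"
  shows "card (interp d \<beta> S - coprime_pairs d)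
    \<le> (\<Sum>t\<in>UNIV. card (interp (d - 1) \<beta> (S - {t})))
      + (\<Sum>e=2..d. card (UNIV :: 'a set) ^ e * card (interp (d - e) \<beta> S))"
proof -
  define M where "M e = {h :: 'a poly. degree h = e \<and> lead_coeff h = 1}" for e
  define A where "A t = mult_pair (point_form t) ` interp (d - 1) \<beta> (S - {t})" for t
  define B where "B e = (\<Union>h\<in>M e. mult_pair h ` interp (d - e) \<beta> S)" for e
  have M: "finite (M e)" "card (M e) \<le> card (UNIV :: 'a set) ^ e" if "e \<in> {2..d}" for e
    using card_monic_le[of e, where 'a = 'a] that by (auto simp: M_def)
  have A: "card (A t) \<le> card (interp (d - 1) \<beta> (S - {t}))" for t
    unfolding A_def by (intro card_image_le finite_interp)
  have B: "card (B e) \<le> card (UNIV :: 'a set) ^ e * card (interp (d - e) \<beta> S)" if "e \<in> {2..d}" for e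
  proof -
    have "card (B e) \<le> (\<Sum>h\<in>M e. card (mult_pair h ` interp (d - e) \<beta> S))"
      unfolding B_def by (rule card_UN_le) (rule M[OF that])
    also have "\<dots> \<le> (\<Sum>h\<in>M e. card (interp (d - e) \<beta> S))"
      by (intro sum_mono card_image_le finite_interp)
    also have "\<dots> \<le> card (UNIV :: 'a set) ^ e * card (interp (d - e) \<beta> S)"
      using M(2)[OF that] by simp
    finally show ?thesis .
  qed
  have sub: "interp d \<beta> S - coprime_pairs d \<subseteq> (\<Union>t. A t) \<union> (\<Union>e\<in>{2..d}. B e)"
  proof
    fix z assume "z \<in> interp d \<beta> S - coprime_pairs d"
    then show "z \<in> (\<Union>t. A t) \<union> (\<Union>e\<in>{2..d}. B e)"
      using not_coprime_interp_cases[of "fst z" "snd z" d \<beta> S] assms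
      by (auto simp: A_def B_def M_def)
  qed
  have "finite (A t)" for t
    unfolding A_def by (intro finite_imageI finite_interp)
  moreover have "finite (B e)" if "e \<in> {2..d}" for e
    unfolding B_def using M(1)[OF that] by (intro finite_UN_I finite_imageI finite_interp)
  ultimately have "finite ((\<Union>t. A t) \<union> (\<Union>e\<in>{2..d}. B e))"
    by auto
  from card_mono[OF this sub]
  have "card (interp d \<beta> S - coprime_pairs d) \<le> card ((\<Union>t. A t) \<union> (\<Union>e\<in>{2..d}. B e))" .
  also have "\<dots> \<le> card (\<Union>t. A t) + card (\<Union>e\<in>{2..d}. B e)"
    by (rule card_Un_le)
  also have "\<dots> \<le> (\<Sum>t\<in>UNIV. card (A t)) + (\<Sum>e=2..d. card (B e))"
    by (intro add_mono card_UN_le) auto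
  also have "\<dots> \<le> (\<Sum>t\<in>UNIV. card (interp (d - 1) \<beta> (S - {t})))
      + (\<Sum>e=2..d. card (UNIV :: 'a set) ^ e * card (interp (d - e) \<beta> S))"
    using A B by (intro add_mono sum_mono) auto
  finally show ?thesis .
qed

lemma card_UNIV_field_ge_2: "card (UNIV :: 'a::{finite, field} set) \<ge> 2"
proof -
  have "card {0, 1 :: 'a} \<le> card (UNIV :: 'a set)"
    by (rule card_mono) auto
  then show ?thesis by simp
qed

lemma card_UNIV_proj: "card (UNIV :: 'a::finite proj set) = card (UNIV :: 'a set) + 1"
proof -
  have "inj (Fin :: 'a \<Rightarrow> _)"
    by (auto intro: injI)
  moreover have "Infty \<notin> range (Fin :: 'a \<Rightarrow> _)"
    by auto
  ultimately show ?thesis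
    by (simp add: UNIV_proj card_image)
qed

text \<open>The extra summand lets the induction close: since \<open>b \<ge> 2\<close>, it can be
  split into two copies of the next power.\<close>

lemma sum_powers_le:
  fixes b :: nat
  assumes "b \<ge> 2" "1 \<le> M" "M \<le> N + 1"
  shows "(\<Sum>e=2..M. b ^ (N + 1 - e)) + b ^ (N + 1 - M) \<le> b ^ N"
  using assms(2,3)
proof (induction M rule: dec_induct)
  case (step M)
  have "2 * b ^ (N + 1 - Suc M) \<le> b * b ^ (N + 1 - Suc M)"
    using assms(1) by (rule mult_right_mono) simp
  also have "\<dots> = b ^ (N + 1 - M)"
    using step by (simp add: Suc_diff_le flip: power_Suc)
  finally have "2 * b ^ (N + 1 - Suc M) \<le> b ^ (N + 1 - M)" .
  with step show ?case
    by simp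
qed simp

text \<open>With k points, the linear factors contribute at most k + 1 times \<open>q ^ N\<close>,
  the factors of moderate degree at most once, and those of high degree at most k - 1 times. The
  total 2k + 1 is at most 3k.\<close>

lemma card_not_coprime_interp_bound:
  fixes S :: "'a::{finite, field} proj set"
  assumes S: "1 \<le> card S" "card S \<le> d"
  shows "card (interp d \<beta> S - coprime_pairs d)
    \<le> 3 * card S * card (UNIV :: 'a set) ^ (2 * d + 1 - card S)"
proof -
  define k where "k = card S"
  define q where "q = card (UNIV :: 'a set)"
  define N where "N = 2 * d + 1 - k"
  have q: "q \<ge> 2" unfolding q_def by (rule card_UNIV_field_ge_2)
  have k: "1 \<le> k" "k \<le> d" using S by (simp_all add: k_def)
  have inS: "card (interp (d - 1) \<beta> (S - {t})) = q ^ N" if "t \<in> S" for t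
  proof -
    have "card (S - {t}) = k - 1" using that by (simp add: k_def)
    moreover have "2 * (d - 1) + 2 - (k - 1) = N" using k by (simp add: N_def)
    ultimately show ?thesis
      using card_interp[of "S - {t}" "d - 1" \<beta>] k by (simp add: q_def)
  qed
  have notS: "card (interp (d - 1) \<beta> (S - {t})) = q ^ (N - 1)" if "t \<in> - S" for t
  proof -
    have "S - {t} = S" using that by auto
    moreover have "2 * (d - 1) + 2 - k = N - 1" using k by (simp add: N_def)
    ultimately show ?thesis
      using card_interp[of "S - {t}" "d - 1" \<beta>] k by (simp add: q_def k_def)
  qed
  have "(\<Sum>t\<in>UNIV. card (interp (d - 1) \<beta> (S - {t})))
      = (\<Sum>t\<in>S. card (interp (d - 1) \<beta> (S - {t}))) + (\<Sum>t\<in>-S. card (interp (d - 1) \<beta> (S - {t})))"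
    by (subst sum.union_disjoint[symmetric]) auto
  also have "\<dots> = k * q ^ N + (q + 1 - k) * q ^ (N - 1)"
    using inS notS by (simp add: k_def q_def Compl_eq_Diff_UNIV card_Diff_subset card_UNIV_proj)
  also have "\<dots> \<le> k * q ^ N + q * q ^ (N - 1)"
    using k by (intro add_mono mult_right_mono) auto
  also have "q * q ^ (N - 1) = q ^ N"
    using power_minus_mult[of N q] k by (simp add: N_def mult.commute)
  finally have 1: "(\<Sum>t\<in>UNIV. card (interp (d - 1) \<beta> (S - {t}))) \<le> k * q ^ N + q ^ N" .
  \<comment> \<open>Up to degree \<open>d + 1 - k\<close> all k conditions on the cofactors remain
    independent, which gives a geometric progression. From \<open>d + 2 - k\<close> on only
    \<open>d - e + 1\<close> conditions are kept and the term is \<open>q ^ (d + 1)\<close>, at most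
    \<open>q ^ N\<close> because \<open>k \<le> d\<close>.\<close>
  have "q ^ e * card (interp (d - e) \<beta> S) \<le> q ^ (N + 1 - e) + (if e \<in> {d + 2 - k..d} then q ^ N else 0)"
    if e: "e \<in> {2..d}" for e
  proof -
    obtain m where dm: "d = e + m"
      using e le_Suc_ex[of e d] by auto
    have "q ^ e * card (interp (d - e) \<beta> S) \<le> q ^ e * q ^ (2 * (d - e) + 2 - min k (d - e + 1))"
      unfolding k_def q_def by (intro mult_left_mono card_interp_le) simp
    also have "\<dots> = q ^ (e + (2 * (d - e) + 2 - min k (d - e + 1)))"
      by (rule power_add[symmetric])
    also have "\<dots> \<le> q ^ (N + 1 - e) + (if e \<in> {d + 2 - k..d} then q ^ N else 0)"
    proof (cases "k \<le> d - e + 1")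
      case True
      then have "e + (2 * (d - e) + 2 - min k (d - e + 1)) = N + 1 - e"
        using e k True by (simp add: N_def dm)
      then show ?thesis by simp
    next
      case False
      then have "e + (2 * (d - e) + 2 - min k (d - e + 1)) \<le> N"
        using e k False by (simp add: N_def dm)
      then have "q ^ (e + (2 * (d - e) + 2 - min k (d - e + 1))) \<le> q ^ N"
        using q by (intro power_increasing) auto
      moreover have "e \<in> {d + 2 - k..d}"
        using False e by auto
      ultimately show ?thesis by simp
    qed
    finally show ?thesis .
  qed
  then have "(\<Sum>e=2..d. q ^ e * card (interp (d - e) \<beta> S))
      \<le> (\<Sum>e=2..d. q ^ (N + 1 - e) + (if e \<in> {d + 2 - k..d} then q ^ N else 0))"
    by (intro sum_mono) auto
  also have "\<dots> = (\<Sum>e=2..d. q ^ (N + 1 - e)) + (\<Sum>e\<in>{2..d} \<inter> {d + 2 - k..d}. q ^ N)"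
    by (simp only: sum.distrib sum.inter_restrict[OF finite_atLeastAtMost])
  also have "(\<Sum>e=2..d. q ^ (N + 1 - e)) \<le> q ^ N"
  proof -
    have "1 \<le> d" "d \<le> N + 1"
      using k unfolding N_def by linarith+
    from sum_powers_le[OF q this] show ?thesis
      by linarith
  qed
  also have "(\<Sum>e\<in>{2..d} \<inter> {d + 2 - k..d}. q ^ N) \<le> (\<Sum>e\<in>{d + 2 - k..d}. q ^ N)"
    by (intro sum_mono2) auto
  also have "\<dots> = (k - 1) * q ^ N"
    using k by simp
  finally have 2: "(\<Sum>e=2..d. q ^ e * card (interp (d - e) \<beta> S)) \<le> q ^ N + (k - 1) * q ^ N"
    by simp
  have "card (interp d \<beta> S - coprime_pairs d) \<le> (k * q ^ N + q ^ N) + (q ^ N + (k - 1) * q ^ N)"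
    using card_not_coprime_interp_le[of d \<beta> S] 1 2 k unfolding q_def by linarith
  also have "\<dots> = (2 * k + 1) * q ^ N"
    using k by (cases k) (simp_all add: algebra_simps)
  also have "\<dots> \<le> 3 * k * q ^ N"
    using k by (intro mult_right_mono) auto
  finally show ?thesis
    by (simp add: k_def q_def N_def)
qed

section \<open>From proportions of interpolating functions to the average number of cycles\<close>

text \<open>Coprime interpolating pairs are compared with all pairs, and the \<open>q - 1\<close>
  scalars per function cancel. The upper bound on the number of functions can be inserted only if
  the factor \<open>1 - 3 * real (card S) / q\<close> is nonnegative; otherwise the claim is
  trivial.\<close>

lemma card_ratfuns_interp_ge:
  fixes S :: "'a::{finite, field} proj set"
  assumes S: "1 \<le> card S" "card S \<le> d"
  defines "q \<equiv> real (card (UNIV :: 'a set))"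
  shows "real (card {F \<in> ratfuns_of_degree d. \<forall>x\<in>S. rat_eval F x = \<beta> x})
    \<ge> real (card (ratfuns_of_degree d :: 'a ratfun set)) * (1 - 3 * real (card S) / q) / q ^ card S"
    (is "real ?A \<ge> real ?R * (1 - 3 * real ?k / q) / q ^ ?k")
proof (cases "1 - 3 * real ?k / q \<ge> 0")
  case False
  have "q > 0" using card_UNIV_field_ge_2[where 'a = 'a] by (simp add: q_def)
  then have "real ?R * (1 - 3 * real ?k / q) / q ^ ?k \<le> 0"
    using False by (intro divide_nonpos_nonneg mult_nonneg_nonpos) auto
  then show ?thesis by linarith
next
  case True
  have q: "q \<ge> 2" using card_UNIV_field_ge_2[where 'a = 'a] by (simp add: q_def)
  have d: "d > 0" using S by simp
  have q1: "real (card (UNIV :: 'a set) - 1) = q - 1"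
    using q by (simp add: q_def of_nat_diff)
  let ?I = "interp d \<beta> S" and ?C = "coprime_pairs d :: ('a poly \<times> 'a poly) set"
  have "card ?I = card (?I \<inter> ?C) + card (?I - ?C)"
    using card_Int_Diff[OF finite_interp] .
  then have "real (card (?I \<inter> ?C)) = real (card ?I) - real (card (?I - ?C))"
    by simp
  moreover have "real (card ?I) = q ^ (2 * d + 2 - ?k)"
    using card_interp[of S d \<beta>] S by (simp add: q_def)
  moreover have "real (card (?I - ?C)) \<le> 3 * real ?k * q ^ (2 * d + 1 - ?k)"
    using card_not_coprime_interp_bound[OF S, of \<beta>, THEN of_nat_mono[where 'a = real]]
    by (simp add: q_def)
  moreover have "real (card (?I \<inter> ?C)) \<le> real ?A * (q - 1)"
    using card_interp_coprime_le[OF d, of \<beta> S, THEN of_nat_mono[where 'a = real]]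
    by (simp only: of_nat_mult q1)
  ultimately have 1: "q ^ (2 * d + 2 - ?k) - 3 * real ?k * q ^ (2 * d + 1 - ?k) \<le> real ?A * (q - 1)"
    by linarith
  have 2: "real ?R * (q - 1) \<le> q ^ (2 * d + 2)"
    using card_ratfuns_of_degree_le[OF d, where 'a = 'a, THEN of_nat_mono[where 'a = real]]
    by (simp only: of_nat_mult q1 of_nat_power q_def)
  have e1: "q ^ (2 * d + 2 - ?k) = q ^ (2 * d + 2) / q ^ ?k"
    using q S by (intro power_diff) auto
  have e2: "q ^ (2 * d + 1 - ?k) = q ^ (2 * d + 2) / q ^ ?k / q"
    using q S power_diff[of q ?k "2 * d + 1"] by simp
  have "real ?R * (1 - 3 * real ?k / q) / q ^ ?k * (q - 1)
      = (real ?R * (q - 1)) * ((1 - 3 * real ?k / q) / q ^ ?k)"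
    by simp
  also have "\<dots> \<le> q ^ (2 * d + 2) * ((1 - 3 * real ?k / q) / q ^ ?k)"
    using True q by (intro mult_right_mono 2) auto
  also have "\<dots> = q ^ (2 * d + 2 - ?k) - 3 * real ?k * q ^ (2 * d + 1 - ?k)"
    unfolding e1 e2 using q by (simp add: field_simps)
  also have "\<dots> \<le> real ?A * (q - 1)"
    by (rule 1)
  finally show ?thesis
    by (rule mult_right_le_imp_le) (use q in simp)
qed

text \<open>The count is the falling factorial with factors q + 1 - j for j < k. The induction rests
  on (1 - j/q)(1 - j^2/q) \<ge> 1 - (j + 1)^2/q. The bound on \<open>k\<close> keeps 1 - j^2/q
  nonnegative, as needed when the factor q - j is enlarged to q + 1 - j.\<close>

lemma card_distinct_lists_ge:
  fixes q :: real
  assumes "k ^ 2 \<le> card (UNIV :: 'a::finite set)"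
  defines "q \<equiv> real (card (UNIV :: 'a set))"
  shows "real (card {xs :: 'a proj list. length xs = k \<and> distinct xs}) \<ge> q ^ k * (1 - real k ^ 2 / q)"
proof -
  define n where "n = card (UNIV :: 'a set)"
  have n: "n > 0" by (simp add: n_def card_gt_0_iff)
  have qn: "q = real n" by (simp add: q_def n_def)
  have "k \<le> k ^ 2" by (simp add: power2_eq_square)
  with assms have k: "k \<le> n" by (simp add: n_def)
  have "real (\<Prod>{n + 2 - j..n + 1}) \<ge> q ^ j * (1 - real j ^ 2 / q)" if "j \<le> k" for j
    using that
  proof (induction j)
    case (Suc j)
    then have j: "j + 1 \<le> n" "j \<le> k" using k by auto
    have "real j ^ 2 \<le> real k ^ 2"
      using j by (intro power_mono) auto
    also have "\<dots> \<le> q"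
      using assms(1) by (simp add: qn n_def flip: of_nat_power)
    finally have j2: "real j ^ 2 / q \<le> 1"
      using n by (simp add: qn)
    have "n + 2 - Suc j = n + 1 - j" "n + 2 - j = Suc (n + 1 - j)"
      using j by auto
    then have "\<Prod>{n + 2 - Suc j..n + 1} = (n + 1 - j) * \<Prod>{n + 2 - j..n + 1}"
      by (simp only: prod.atLeast_Suc_atMost[of "n + 1 - j" "n + 1"] diff_le_self)
    then have P: "real (\<Prod>{n + 2 - Suc j..n + 1}) = (q + 1 - real j) * real (\<Prod>{n + 2 - j..n + 1})"
      using j by (simp add: qn of_nat_diff)
    have "(1 - a) * (1 - b) = 1 - (a + b) + a * b" for a b :: real
      by (simp add: algebra_simps)
    then have "(1 - real j / q) * (1 - real j ^ 2 / q)
        = 1 - (real j + real j ^ 2) / q + (real j / q) * (real j ^ 2 / q)"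
      by (simp only: add_divide_distrib)
    moreover have "(real j / q) * (real j ^ 2 / q) \<ge> 0"
      by (simp add: qn)
    moreover have "(real j + real j ^ 2) / q \<le> real (Suc j) ^ 2 / q"
      by (rule divide_right_mono) (simp_all add: qn power2_eq_square algebra_simps)
    ultimately have "1 - real (Suc j) ^ 2 / q \<le> (1 - real j / q) * (1 - real j ^ 2 / q)"
      by linarith
    then have "q ^ Suc j * (1 - real (Suc j) ^ 2 / q)
        \<le> q ^ Suc j * ((1 - real j / q) * (1 - real j ^ 2 / q))"
      by (rule mult_left_mono) (simp add: qn)
    also have "\<dots> = (q - real j) * (q ^ j * (1 - real j ^ 2 / q))"
      using n by (simp add: qn field_simps)
    also have "\<dots> \<le> (q + 1 - real j) * (q ^ j * (1 - real j ^ 2 / q))"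
      using j2 by (intro mult_right_mono) (auto simp: qn)
    also have "\<dots> \<le> (q + 1 - real j) * real (\<Prod>{n + 2 - j..n + 1})"
      using Suc j by (intro mult_left_mono) (auto simp: qn)
    finally show ?case
      unfolding P .
  qed simp
  moreover have "card {xs :: 'a proj list. length xs = k \<and> distinct xs} = \<Prod>{n + 2 - k..n + 1}"
    using card_lists_distinct_length_eq[of "UNIV :: 'a proj set" k] k
    by (simp add: card_UNIV_proj n_def Suc_diff_le)
  ultimately show ?thesis by simp
qed

text \<open>In a list of distinct points each entry has one index and hence one cyclic successor;
  \<beta> sends it there and depends on the list alone, not on \<open>F\<close>.\<close>

lemma cycle_list_iff_interp:
  fixes xs :: "'a::field proj list"
  assumes "xs \<noteq> []" "distinct xs"
  shows "\<exists>\<beta>. \<forall>F. xs \<in> cycle_lists (functional_graph F) \<longleftrightarrow> (\<forall>x\<in>set xs. rat_eval F x = \<beta> x)"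
proof -
  let ?k = "length xs"
  define \<beta> where "\<beta> x = xs ! (Suc (the_inv_into {..<?k} ((!) xs) x) mod ?k)" for x
  have inj: "inj_on ((!) xs) {..<?k}"
    using assms(2) by (intro inj_on_nth) auto
  have "\<beta> (xs ! i) = xs ! (Suc i mod ?k)" if "i < ?k" for i
    unfolding \<beta>_def using the_inv_into_f_f[OF inj, of i] that by simp
  then show ?thesis
    using assms by (intro exI[of _ \<beta>])
      (auto simp: cycle_lists_def functional_graph_def all_set_conv_all_nth)
qed

text \<open>There are functions of every degree, so the average has a positive denominator.\<close>

lemma monom_mem_ratfuns_of_degree: "Fin (Fract (monom 1 d) 1) \<in> ratfuns_of_degree d"
proof -
  have "is_reduced (Fract (monom 1 d) 1 :: 'a poly fract) (monom 1 d) 1"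
    by (simp add: is_reduced_def)
  then show ?thesis
    by (simp add: is_reduced_iff_reduced ratfuns_of_degree_def degree_monom_eq)
qed

text \<open>Double counting of pairs of a function and one of its cycle lists, each list of length k
  having weight 1/k.\<close>

lemma avg_cycles_ge:
  fixes n :: nat
  assumes "n \<le> d" "n ^ 2 \<le> card (UNIV :: 'a::{finite, field} set)"
  defines "q \<equiv> real (card (UNIV :: 'a set))"
  shows "avg_cycles TYPE('a) d \<ge> (\<Sum>k=1..n. 1 / real k * (1 - (real k ^ 2 + 3 * real k) / q))"
proof -
  let ?R = "ratfuns_of_degree d :: 'a ratfun set"
  let ?D = "\<lambda>k. {xs :: 'a proj list. length xs = k \<and> distinct xs}"
  define L where "L F = cycle_lists (functional_graph F)" for F :: "'a ratfun"
  define X where "X k xs = {F \<in> ?R. xs \<in> L F}" for k :: nat and xs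
  have q: "q > 0" using card_UNIV_field_ge_2[where 'a = 'a] by (simp add: q_def)
  have finR: "finite ?R" by (rule finite_ratfuns_of_degree)
  have finD: "finite (?D k)" for k
    using finite_lists_length_eq[of "UNIV :: 'a proj set" k] by (rule rev_finite_subset) auto
  have finL: "finite (L F)" for F
  proof -
    have "finite {xs :: 'a proj list. set xs \<subseteq> UNIV \<and> distinct xs}"
      by (rule finite_subset_distinct) simp
    then show ?thesis
      unfolding L_def by (rule rev_finite_subset) (auto simp: cycle_lists_def)
  qed
  \<comment> \<open>Cycles longer than \<open>n\<close> are discarded here. Lists of different
    lengths are distinct, so the double sum runs over a part of \<open>L F\<close>.\<close>
  have cyc: "(\<Sum>k=1..n. \<Sum>xs\<in>?D k. if xs \<in> L F then 1 / real k else 0)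
      \<le> real (card (cycles (functional_graph F)))" for F
  proof -
    have "(\<Sum>k=1..n. \<Sum>xs\<in>?D k. if xs \<in> L F then 1 / real k else 0)
        = (\<Sum>k=1..n. \<Sum>xs\<in>?D k \<inter> L F. 1 / real (length xs))"
      unfolding sum.inter_restrict[OF finD] by (intro sum.cong) auto
    also have "\<dots> = (\<Sum>xs\<in>(\<Union>k\<in>{1..n}. ?D k \<inter> L F). 1 / real (length xs))"
      using finD by (intro sum.UNION_disjoint[symmetric]) auto
    also have "\<dots> \<le> (\<Sum>xs\<in>L F. 1 / real (length xs))"
      using finL by (intro sum_mono2) auto
    also have "\<dots> \<le> real (card (cycles (functional_graph F)))"
      unfolding L_def by (rule card_cycles_ge)
    finally show ?thesis .
  qed
  have k_bound: "1 / real k * (1 - (real k ^ 2 + 3 * real k) / q) * real (card ?R)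
      \<le> (\<Sum>xs\<in>?D k. real (card (X k xs)) / real k)" if k: "k \<in> {1..n}" for k
  proof (cases "1 - 3 * real k / q \<ge> 0")
    case False
    have "(real k ^ 2 + 3 * real k) / q \<ge> 3 * real k / q"
      using q by (intro divide_right_mono) auto
    with False have "1 - (real k ^ 2 + 3 * real k) / q \<le> 0"
      by linarith
    then have "1 / real k * (1 - (real k ^ 2 + 3 * real k) / q) * real (card ?R) \<le> 0"
      by (intro mult_nonpos_nonneg mult_nonneg_nonpos) auto
    also have "\<dots> \<le> (\<Sum>xs\<in>?D k. real (card (X k xs)) / real k)"
      by (intro sum_nonneg) auto
    finally show ?thesis .
  next
    case True
    have X: "real (card (X k xs)) \<ge> real (card ?R) * (1 - 3 * real k / q) / q ^ k" if xs: "xs \<in> ?D k" for xs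
    proof -
      obtain \<beta> where "\<And>F. xs \<in> L F \<longleftrightarrow> (\<forall>x\<in>set xs. rat_eval F x = \<beta> x)"
        using cycle_list_iff_interp[of xs] xs k unfolding L_def by force
      then have "X k xs = {F \<in> ?R. \<forall>x\<in>set xs. rat_eval F x = \<beta> x}"
        by (simp add: X_def)
      moreover have "card (set xs) = k"
        using xs by (auto simp: distinct_card)
      ultimately show ?thesis
        using card_ratfuns_interp_ge[of "set xs" d \<beta>] k assms(1) by (simp add: q_def)
    qed
    have "k ^ 2 \<le> n ^ 2"
      using k by (intro power_mono) auto
    also note assms(2)
    finally have D: "q ^ k * (1 - real k ^ 2 / q) \<le> real (card (?D k))"
      unfolding q_def by (rule card_distinct_lists_ge)
    \<comment> \<open>The discarded cross term is the product of the two relative errors, hence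
      nonnegative.\<close>
    have "1 - (real k ^ 2 + 3 * real k) / q \<le> (1 - real k ^ 2 / q) * (1 - 3 * real k / q)"
      using q by (simp add: algebra_simps add_divide_distrib)
    then have "1 / real k * (1 - (real k ^ 2 + 3 * real k) / q) * real (card ?R)
        \<le> 1 / real k * ((1 - real k ^ 2 / q) * (1 - 3 * real k / q)) * real (card ?R)"
      by (intro mult_right_mono mult_left_mono) auto
    also have "\<dots> = (q ^ k * (1 - real k ^ 2 / q)) * (real (card ?R) * (1 - 3 * real k / q) / q ^ k / real k)"
      using q by simp
    \<comment> \<open>The second factor must be nonnegative here, hence the case
      distinction.\<close>
    also have "\<dots> \<le> real (card (?D k)) * (real (card ?R) * (1 - 3 * real k / q) / q ^ k / real k)"
      using True q by (intro mult_right_mono D) auto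
    also have "\<dots> = (\<Sum>xs\<in>?D k. real (card ?R) * (1 - 3 * real k / q) / q ^ k / real k)"
      by simp
    also have "\<dots> \<le> (\<Sum>xs\<in>?D k. real (card (X k xs)) / real k)"
      by (intro sum_mono divide_right_mono X) auto
    finally show ?thesis .
  qed
  have "(\<Sum>k=1..n. 1 / real k * (1 - (real k ^ 2 + 3 * real k) / q)) * real (card ?R)
      \<le> (\<Sum>k=1..n. \<Sum>xs\<in>?D k. real (card (X k xs)) / real k)"
    unfolding sum_distrib_right by (intro sum_mono k_bound)
  also have "\<dots> = (\<Sum>k=1..n. \<Sum>xs\<in>?D k. \<Sum>F\<in>?R. if xs \<in> L F then 1 / real k else 0)"
    using finR by (intro sum.cong) (auto simp: X_def simp flip: sum.inter_filter)
  \<comment> \<open>Exchanging sums turns the number of functions per list into the number of lists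
    per function.\<close>
  also have "\<dots> = (\<Sum>k=1..n. \<Sum>F\<in>?R. \<Sum>xs\<in>?D k. if xs \<in> L F then 1 / real k else 0)"
    by (intro sum.cong refl sum.swap)
  also have "\<dots> = (\<Sum>F\<in>?R. \<Sum>k=1..n. \<Sum>xs\<in>?D k. if xs \<in> L F then 1 / real k else 0)"
    by (rule sum.swap)
  also have "\<dots> \<le> (\<Sum>F\<in>?R. real (card (cycles (functional_graph F))))"
    by (intro sum_mono cyc)
  finally have *: "(\<Sum>k=1..n. 1 / real k * (1 - (real k ^ 2 + 3 * real k) / q)) * real (card ?R)
      \<le> (\<Sum>F\<in>?R. real (card (cycles (functional_graph F))))" .
  have "real (card ?R) > 0"
    using finR monom_mem_ratfuns_of_degree[of d, where 'a = 'a] by (auto simp: card_gt_0_iff)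
  with * show ?thesis
    unfolding avg_cycles_def by (simp only: pos_le_divide_eq)
qed

section \<open>Harmonic sums and the final estimate\<close>

text \<open>The logarithm telescopes into the terms ln (1 + 1/k), each smaller than 1/k.\<close>

lemma ln_less_harmonic:
  assumes "n > 0"
  shows "ln (real n + 1) < (\<Sum>k=1..n. 1 / real k)"
  using assms
proof (induction n rule: nat_induct_non_zero)
  case 1
  then show ?case using ln_less_self[of 2] ln_add_one_self_less_self[of 1] by simp
next
  case (Suc n)
  have "ln (real (Suc n) + 1) = ln ((real n + 1) * (1 + 1 / real (Suc n)))"
    by (rule arg_cong[of _ _ ln]) (simp add: field_simps)
  also have "\<dots> = ln (real n + 1) + ln (1 + 1 / real (Suc n))"
    by (rule ln_mult_pos) (auto intro: add_pos_pos)
  also have "\<dots> < (\<Sum>k=1..n. 1 / real k) + 1 / real (Suc n)"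
    using Suc ln_add_one_self_less_self[of "1 / real (Suc n)"] by (intro add_strict_mono) auto
  finally show ?case by simp
qed

theorem theorem3p6:
  fixes q d :: nat
  assumes "primepow q"
    and "card (UNIV :: 'a::{finite, field} set) = q"
  shows "avg_cycles TYPE('a) d > (\<Sum>k = 1..min d (nat \<lfloor>sqrt (real q)\<rfloor>). 1 / real k) - 4
    \<and> (\<Sum>k = 1..min d (nat \<lfloor>sqrt (real q)\<rfloor>). 1 / real k) - 4
        \<ge> ln (real (min d (nat \<lfloor>sqrt (real q)\<rfloor>)) + 1) - 4
    \<and> (d > 0 \<longrightarrow>
        (\<Sum>k = 1..min d (nat \<lfloor>sqrt (real q)\<rfloor>). 1 / real k) - 4
          > ln (real (min d (nat \<lfloor>sqrt (real q)\<rfloor>)) + 1) - 4)"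
proof -
  define n where "n = min d (nat \<lfloor>sqrt (real q)\<rfloor>)"
  have q: "q \<ge> 2"
    using card_UNIV_field_ge_2[where 'a = 'a] assms(2) by simp
  have "real n \<le> real (nat \<lfloor>sqrt (real q)\<rfloor>)"
    unfolding n_def by (intro of_nat_mono) simp
  also have "\<dots> \<le> sqrt (real q)"
    by (rule of_nat_floor) simp
  finally have "real n \<le> sqrt (real q)" .
  then have "real n ^ 2 \<le> real q"
    using power_mono[of "real n" "sqrt (real q)" 2] by simp
  then have n2: "n ^ 2 \<le> q"
    by (simp flip: of_nat_power)
  have n_pos: "n > 0" if "d > 0"
    using that q by (simp add: n_def le_floor_iff less_floor_iff flip: zless_nat_eq_int_zless)
  \<comment> \<open>The total loss will be (n^2 + 7n)/(2q), so this is exactly the condition for it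
    to stay below 4.\<close>
  have "n ^ 2 + 7 * n < 8 * q"
  proof (cases "n \<le> 1")
    case True
    then show ?thesis using q by (cases n) auto
  next
    case False
    then have "n < n ^ 2" by (simp add: power2_eq_square)
    with n2 show ?thesis by linarith
  qed
  then have n_q: "real n ^ 2 + 7 * real n < 8 * real q"
    by (metis of_nat_add of_nat_less_iff of_nat_mult of_nat_numeral of_nat_power)
  have sum_k: "(\<Sum>k=1..n. real k + 3) = (real n ^ 2 + 7 * real n) / 2"
    by (induction n) (simp_all add: power2_eq_square field_simps)
  \<comment> \<open>Dividing the error of the k-cycles by k leaves a loss of (k + 3)/q in each
    term.\<close>
  have "(\<Sum>k=1..n. 1 / real k * (1 - (real k ^ 2 + 3 * real k) / real q))
      = (\<Sum>k=1..n. 1 / real k - (real k + 3) / real q)"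
    using q by (intro sum.cong) (auto simp: field_simps power2_eq_square)
  also have "\<dots> = (\<Sum>k=1..n. 1 / real k) - (real n ^ 2 + 7 * real n) / 2 / real q"
    by (simp only: sum_subtractf sum_k flip: sum_divide_distrib)
  finally have "avg_cycles TYPE('a) d \<ge> (\<Sum>k=1..n. 1 / real k) - (real n ^ 2 + 7 * real n) / 2 / real q"
    using avg_cycles_ge[of n d, where 'a = 'a] n2 assms(2) by (simp add: n_def)
  moreover have "(real n ^ 2 + 7 * real n) / 2 / real q < 4"
    using n_q q by (simp add: divide_less_eq)
  ultimately have "avg_cycles TYPE('a) d > (\<Sum>k=1..n. 1 / real k) - 4"
    by linarith
  \<comment> \<open>For \<open>d = 0\<close> the sum is empty and both sides equal -4, so the
    inequality is strict only for \<open>d > 0\<close>, where \<open>n > 0\<close>.\<close>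
  moreover have "(\<Sum>k=1..n. 1 / real k) - 4 \<ge> ln (real n + 1) - 4"
    using ln_less_harmonic[of n] by (cases "n = 0") auto
  moreover have "d > 0 \<longrightarrow> (\<Sum>k=1..n. 1 / real k) - 4 > ln (real n + 1) - 4"
    using ln_less_harmonic[of n] n_pos by simp
  ultimately show ?thesis
    unfolding n_def by blast
qed

end
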